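(* Let $\Phi$ be a root system of type $E_6$, $j\in\{1,6\}$ and $\omega=\omega_j$. Then the set $\Phi_{\omega,0}^+=\{\beta\in\Phi^+:\beta^\omega=0\}$ consists of exactly the six roots $$\tfrac12(e_1+e_2+e_3-e_4-e_5-e_6-e_7+e_8),\quad \tfrac12(-e_1-e_2-e_3+e_4-e_5-e_6-e_7+e_8),\quad e_5+e_1,\quad e_5-e_1,$$ $$\tfrac12(-e_1+e_2+e_3-e_4+e_5-e_6-e_7+e_8),\quad \tfrac12(e_1-e_2-e_3+e_4+e_5-e_6-e_7+e_8),$$ that is, $$\Phi_{\omega,0}^+=\{\alpha_1+\alpha_2+\alpha_3+\alpha_4,\ \alpha_1+\alpha_3+\alpha_4+\alpha_5,\ \alpha_2+\alpha_4+\alpha_5+\alpha_6,\ \alpha_3+\alpha_4+\alpha_5+\alpha_6,$$ $$\alpha_1+\alpha_2+2\alpha_3+2\alpha_4+\alpha_5+\alpha_6,\ \alpha_1+\alpha_2+\alpha_3+2\alpha_4+2\alpha_5+\alpha_6\}.$$ Hence $P(0)=\{\pm1,\pm2\}$.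
   Context: With $e_1,\dots,e_8$ the standard basis of $\mathbb{R}^8$, $\Phi$ of type $E_6$ has positive roots $\Phi^+=\{e_i\pm e_k:1\le k<i\le5\}\sqcup\{\tfrac12(\nu_1e_1+\cdots+\nu_5e_5-e_6-e_7+e_8):\nu_1,\dots,\nu_5\in\{\pm1\},\ \nu_1\cdots\nu_5=1\}$, and basis $\Delta$: $\alpha_1=\tfrac12(e_1-e_2-e_3-e_4-e_5-e_6-e_7+e_8)$, $\alpha_2=e_1+e_2$, $\alpha_3=e_2-e_1$, $\alpha_4=e_3-e_2$, $\alpha_5=e_4-e_3$, $\alpha_6=e_5-e_4$; $E$ is the span of $\Phi$. Let $\tilde\alpha=\sum_{i=1}^6n_i\alpha_i$ be the highest root, $\alpha_0=-\tilde\alpha$, $n_0=1$; then $J=\{i\in\{0,\dots,6\}:n_i=1\}=\{0,1,6\}$. For $j\in\{1,6\}$ let $w_j$ be the longest element of the subgroup of the Weyl group $W$ generated by the $s_{\alpha_i}$, $i\in\{1,\dots,6\}\setminus\{j\}$, $w_0$ the longest element of $W$, and $\omega_j=w_jw_0$; it acts on $\{\alpha_0,\dots,\alpha_6\}$ by the index permutation $\sigma_1=(0\ 1\ 6)(2\ 3\ 5)$ if $j=1$ and $\sigma_6=\sigma_1^{-1}$ if $j=6$. Put $x^\omega=\frac1{o(\omega)}\sum_{t=1}^{o(\omega)}\omega^t(x)$ with $o(\omega)=3$ the order of $\omega=\omega_j$. Let $\varpi_1^\vee,\dots,\varpi_6^\vee\in E$ be the dual basis of $\Delta$, $\varpi_0^\vee=0$,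 and $\pi_0^j=\varpi_0^\vee+\varpi_1^\vee+\varpi_6^\vee$ the sum over the $\langle\sigma_j\rangle$-orbit of $0$. Put $P(0)=\{(\gamma,\pi_0^j):\gamma\in\Phi,\ \gamma^\omega=0\}$. *)

theory Defs
  imports
    "HOL-Analysis.Analysis"
    "HOL-Algebra.Bij"
    "HOL-Algebra.Generated_Groups"
    "HOL-Algebra.Multiplicative_Group"
    "HOL-Combinatorics.Orbits"
begin

text \<open>The index type \<open>8\<close> is the integers mod 8, so \<open>of_nat 1, \<dots>, of_nat 8\<close> are its eight
  distinct elements (with \<open>of_nat 8 = 0\<close>), and \<open>std 1, \<dots>, std 8\<close> is the standard basis.\<close>

definition std :: "nat \<Rightarrow> real^8" where
  "std i = axis (of_nat i) 1"

definition positive_roots :: "(real^8) set" where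
  "positive_roots =
     {std i + std k | i k. 1 \<le> k \<and> k < i \<and> i \<le> 5}
   \<union> {std i - std k | i k. 1 \<le> k \<and> k < i \<and> i \<le> 5}
   \<union> {(1/2) *\<^sub>R ((\<Sum>i=1..5. \<nu> i *\<^sub>R std i) - std 6 - std 7 + std 8) | \<nu> :: nat \<Rightarrow> real.
        (\<forall>i\<in>{1..5}. \<nu> i \<in> {1, -1}) \<and> (\<Prod>i=1..5. \<nu> i) = 1}"

definition roots :: "(real^8) set" where
  "roots = positive_roots \<union> uminus ` positive_roots"

definition simple_root :: "nat \<Rightarrow> real^8" where
  "simple_root i =
    (if i = 1 then (1/2) *\<^sub>R (std 1 - std 2 - std 3 - std 4 - std 5 - std 6 - std 7 + std 8)
     else if i = 2 then std 1 + std 2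
     else if i = 3 then std 2 - std 1
     else if i = 4 then std 3 - std 2
     else if i = 5 then std 4 - std 3
     else if i = 6 then std 5 - std 4
     else 0)"

definition highest_root :: "real^8" where
  "highest_root = (THE \<beta>. \<beta> \<in> roots \<and>
     (\<forall>\<gamma>\<in>roots. \<exists>c :: nat \<Rightarrow> nat. \<beta> - \<gamma> = (\<Sum>i=1..6. of_nat (c i) *\<^sub>R simple_root i)))"

definition affine_root :: "nat \<Rightarrow> real^8" where
  "affine_root i = (if i = 0 then - highest_root else simple_root i)"

text \<open>The Weyl group is taken to act on the whole of \<open>\<real>\<^sup>8\<close>, trivially on the orthogonal
  complement of the span \<open>E\<close> of the roots.\<close>

definition root_reflection :: "real^8 \<Rightarrow> real^8 \<Rightarrow> real^8" where
  "root_reflection \<beta> x = x - (2 * (x \<bullet> \<beta>) / (\<beta> \<bullet> \<beta>)) *\<^sub>R \<beta>"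

definition weyl_group :: "(real^8 \<Rightarrow> real^8) set" where
  "weyl_group = generate (BijGroup UNIV) (root_reflection ` roots)"

definition parabolic :: "nat set \<Rightarrow> (real^8 \<Rightarrow> real^8) set" where
  "parabolic I = generate (BijGroup UNIV) (root_reflection ` simple_root ` I)"

definition weyl_length :: "(real^8 \<Rightarrow> real^8) \<Rightarrow> nat" where
  "weyl_length w = (LEAST k. \<exists>is. length is = k \<and> set is \<subseteq> {1..6} \<and>
     w = foldr (\<lambda>i f. root_reflection (simple_root i) \<circ> f) is id)"

definition longest :: "(real^8 \<Rightarrow> real^8) set \<Rightarrow> (real^8 \<Rightarrow> real^8)" where
  "longest H = (THE w. w \<in> H \<and> (\<forall>v\<in>H. weyl_length v \<le> weyl_length w))"

definition omega :: "nat \<Rightarrow> real^8 \<Rightarrow> real^8" where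
  "omega j = longest (parabolic ({1..6} - {j})) \<circ> longest weyl_group"

definition average :: "(real^8 \<Rightarrow> real^8) \<Rightarrow> real^8 \<Rightarrow> real^8" where
  "average w x =
     (let n = group.ord (BijGroup UNIV) w
      in (1 / of_nat n) *\<^sub>R (\<Sum>t=1..n. (w ^^ t) x))"

text \<open>The permutation of the indices \<open>0, \<dots>, 6\<close> that describes the action of \<open>omega j\<close> on
  \<open>affine_root 0, \<dots>, affine_root 6\<close>: for \<open>j = 1\<close> it is \<open>(0 1 6)(2 3 5)\<close>, and for \<open>j = 6\<close>
  the inverse of that.\<close>

definition index_perm :: "nat \<Rightarrow> nat \<Rightarrow> nat" where
  "index_perm j i = (THE k. k \<in> {0..6} \<and> omega j (affine_root i) = affine_root k)"

definition fund_coweight :: "nat \<Rightarrow> real^8" where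
  "fund_coweight i =
     (if i = 0 then 0
      else (THE v. v \<in> span roots \<and>
              (\<forall>k\<in>{1..6}. simple_root k \<bullet> v = (if k = i then 1 else 0))))"

definition pi0 :: "nat \<Rightarrow> real^8" where
  "pi0 j = (\<Sum>i\<in>orbit (index_perm j) 0. fund_coweight i)"

definition P0 :: "nat \<Rightarrow> real set" where
  "P0 j = {\<gamma> \<bullet> pi0 j | \<gamma>. \<gamma> \<in> roots \<and> average (omega j) \<gamma> = 0}"

definition positive_roots_avg0 :: "nat \<Rightarrow> (real^8) set" where
  "positive_roots_avg0 j = {\<beta> \<in> positive_roots. average (omega j) \<beta> = 0}"

end

theory Submission
  imports Defs
begin

text \<open>
  The element \<open>omega j\<close> permutes the affine simple roots by the 3-cycles \<open>(0 1 6)(2 3 5)\<close> or their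
  inverses. Writing \<open>\<beta> = \<Sum> c\<^sub>i \<alpha>\<^sub>i\<close> and using \<open>\<alpha>\<^sub>0 = - (\<alpha>\<^sub>1 + 2 \<alpha>\<^sub>2 + 2 \<alpha>\<^sub>3 + 3 \<alpha>\<^sub>4 + 2 \<alpha>\<^sub>5 + \<alpha>\<^sub>6)\<close>,
  the sum of \<open>\<beta>\<close> and its two further images under \<open>omega j\<close> has every coefficient at \<open>\<alpha>\<^sub>2\<close>, \<open>\<alpha>\<^sub>3\<close>, \<open>\<alpha>\<^sub>5\<close> equal to
  \<open>c\<^sub>2 + c\<^sub>3 + c\<^sub>5 - 2 (c\<^sub>1 + c\<^sub>6)\<close>, the coefficient \<open>3 (c\<^sub>4 - c\<^sub>1 - c\<^sub>6)\<close> at \<open>\<alpha>\<^sub>4\<close>, and \<open>0\<close> at \<open>\<alpha>\<^sub>1\<close>, \<open>\<alpha>\<^sub>6\<close>.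
  So the average vanishes iff \<open>c\<^sub>4 = c\<^sub>1 + c\<^sub>6\<close> and \<open>c\<^sub>2 + c\<^sub>3 + c\<^sub>5 = 2 (c\<^sub>1 + c\<^sub>6)\<close>
  (\<open>average_omega_comb_eq_0_iff\<close>), and six of the 36 positive roots satisfy this. Pairing with
  \<open>pi0 j = \<varpi>\<^sub>1 + \<varpi>\<^sub>6\<close> reads off \<open>c\<^sub>1 + c\<^sub>6\<close>, which takes the values 1 and 2 on these six roots.

  The substantial part is to identify \<open>omega j\<close>, which is defined through elements of maximal
  length, where length is the minimal number of simple reflections. The deletion property
  (\<open>deletion\<close>) shows that length counts the positive roots made negative
  (\<open>weyl_length_eq_card_inversions\<close>). An element without inversions is therefore the identity
  (\<open>word_map_eq_id\<close>), and hence an element of a parabolic subgroup that makes every positive root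
  of that subgroup negative is the unique longest one (\<open>longest_eqI\<close>). It remains to exhibit
  one word for the whole Weyl group and one for each of the two maximal parabolic subgroups, which
  is a finite computation with integer coefficient vectors. That \<open>omega j\<close> has order 3 on all of
  \<open>\<real>\<^sup>8\<close>, not only on the span of the roots, also follows from \<open>word_map_eq_id\<close>:
  its cube is a word in simple reflections that fixes every positive root.
\<close>

section \<open>Roots in the basis of simple roots\<close>

text \<open>The indices of \<open>std\<close> are read modulo 8, so the vectors are orthonormal only because the
  residues of \<open>1, \<dots>, 8\<close> are pairwise distinct.\<close>

lemma std_inner_std:
  assumes "i \<in> {1..8}" "k \<in> {1..8}"
  shows "std i \<bullet> std k = (if i = k then 1 else 0)"
proof -
  have no_wrap: "(of_nat m :: 8) \<noteq> of_nat n" if "m < n" "m \<in> {1..8}" "n \<in> {1..8}" for m n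
  proof
    assume "(of_nat m :: 8) = of_nat n"
    then have "8 dvd n - m"
      using of_nat_eq_iff_char_dvd[OF \<open>m < n\<close>, where 'a = 8] by simp
    then show False
      using that by (auto dest: dvd_imp_le)
  qed
  have "(of_nat i :: 8) = of_nat k \<longleftrightarrow> i = k"
    using no_wrap[of i k] no_wrap[of k i] assms by (cases i k rule: linorder_cases) auto
  then show ?thesis
    by (simp add: std_def inner_axis_axis)
qed

definition std_comb :: "real \<Rightarrow> real \<Rightarrow> real \<Rightarrow> real \<Rightarrow> real \<Rightarrow> real \<Rightarrow> real \<Rightarrow> real \<Rightarrow> real^8" where
  "std_comb a b c d e f g h =
     a *\<^sub>R std 1 + b *\<^sub>R std 2 + c *\<^sub>R std 3 + d *\<^sub>R std 4
     + e *\<^sub>R std 5 + f *\<^sub>R std 6 + g *\<^sub>R std 7 + h *\<^sub>R std 8"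

lemma std_as_std_comb:
  "std 1 = std_comb 1 0 0 0 0 0 0 0" "std (Suc 0) = std_comb 1 0 0 0 0 0 0 0"
  "std 2 = std_comb 0 1 0 0 0 0 0 0"
  "std 3 = std_comb 0 0 1 0 0 0 0 0" "std 4 = std_comb 0 0 0 1 0 0 0 0"
  "std 5 = std_comb 0 0 0 0 1 0 0 0" "std 6 = std_comb 0 0 0 0 0 1 0 0"
  "std 7 = std_comb 0 0 0 0 0 0 1 0" "std 8 = std_comb 0 0 0 0 0 0 0 1"
  by (simp_all add: std_comb_def)

lemma std_comb_arith:
  "std_comb a b c d e f g h + std_comb a' b' c' d' e' f' g' h'
     = std_comb (a + a') (b + b') (c + c') (d + d') (e + e') (f + f') (g + g') (h + h')"
  "std_comb a b c d e f g h - std_comb a' b' c' d' e' f' g' h'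
     = std_comb (a - a') (b - b') (c - c') (d - d') (e - e') (f - f') (g - g') (h - h')"
  "- std_comb a b c d e f g h = std_comb (- a) (- b) (- c) (- d) (- e) (- f) (- g) (- h)"
  "r *\<^sub>R std_comb a b c d e f g h
     = std_comb (r * a) (r * b) (r * c) (r * d) (r * e) (r * f) (r * g) (r * h)"
  by (simp_all add: std_comb_def scaleR_add_left scaleR_diff_left scaleR_add_right)

lemma inner_std_comb:
  "std_comb a b c d e f g h \<bullet> std_comb a' b' c' d' e' f' g' h'
     = a * a' + b * b' + c * c' + d * d' + e * e' + f * f' + g * g' + h * h'"
  unfolding std_comb_def by (simp add: inner_add_left inner_add_right std_inner_std)

lemma std_comb_eq_iff:
  "std_comb a b c d e f g h = std_comb a' b' c' d' e' f' g' h' \<longleftrightarrow>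
     a = a' \<and> b = b' \<and> c = c' \<and> d = d' \<and> e = e' \<and> f = f' \<and> g = g' \<and> h = h'"
proof
  let ?v = "std_comb a b c d e f g h" and ?v' = "std_comb a' b' c' d' e' f' g' h'"
  assume eq: "?v = ?v'"
  have "?v \<bullet> std k = ?v' \<bullet> std k" for k
    by (simp add: eq)
  from this[of 1] this[of 2] this[of 3] this[of 4] this[of 5] this[of 6] this[of 7] this[of 8]
  show "a = a' \<and> b = b' \<and> c = c' \<and> d = d' \<and> e = e' \<and> f = f' \<and> g = g' \<and> h = h'"
    unfolding std_as_std_comb by (simp add: inner_std_comb)
qed simp

text \<open>Coefficients in the basis of simple roots are kept as integer lists of length 6, so that
  statements about all roots become statements about lists that rewriting decides.\<close>

fun comb :: "int list \<Rightarrow> real^8" where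
  "comb [a, b, c, d, e, f] =
     of_int a *\<^sub>R simple_root 1 + of_int b *\<^sub>R simple_root 2 + of_int c *\<^sub>R simple_root 3
     + of_int d *\<^sub>R simple_root 4 + of_int e *\<^sub>R simple_root 5 + of_int f *\<^sub>R simple_root 6"
| "comb _ = 0"

lemma length_6E:
  assumes "length c = 6"
  obtains a1 a2 a3 a4 a5 a6 where "c = [a1, a2, a3, a4, a5, a6]"
  using assms by (auto simp: numeral_eq_Suc length_Suc_conv)

lemma comb_as_std_comb:
  "comb [a, b, c, d, e, f] =
     std_comb (a / 2 + b - c) (- a / 2 + b + c - d) (- a / 2 + d - e) (- a / 2 + e - f)
       (- a / 2 + f) (- a / 2) (- a / 2) (a / 2)"
  by (simp add: simple_root_def std_as_std_comb std_comb_arith std_comb_eq_iff)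

declare comb.simps(1) [simp del]

lemma comb_eq_iff:
  assumes "length c = 6" "length c' = 6"
  shows "comb c = comb c' \<longleftrightarrow> c = c'"
proof -
  obtain a1 a2 a3 a4 a5 a6 where c: "c = [a1, a2, a3, a4, a5, a6]"
    using assms(1) by (rule length_6E)
  obtain b1 b2 b3 b4 b5 b6 where c': "c' = [b1, b2, b3, b4, b5, b6]"
    using assms(2) by (rule length_6E)
  show ?thesis
    unfolding c c' comb_as_std_comb std_comb_eq_iff by auto
qed

definition pos_coeffs :: "int list list" where
  "pos_coeffs =
    [[1, 0, 0, 0, 0, 0], [0, 1, 0, 0, 0, 0], [0, 0, 1, 0, 0, 0],
     [0, 0, 0, 1, 0, 0], [0, 0, 0, 0, 1, 0], [0, 0, 0, 0, 0, 1],
     [1, 0, 1, 0, 0, 0], [0, 1, 0, 1, 0, 0], [0, 0, 1, 1, 0, 0],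
     [0, 0, 0, 1, 1, 0], [0, 0, 0, 0, 1, 1], [1, 0, 1, 1, 0, 0],
     [0, 1, 1, 1, 0, 0], [0, 1, 0, 1, 1, 0], [0, 0, 1, 1, 1, 0],
     [0, 0, 0, 1, 1, 1], [1, 1, 1, 1, 0, 0], [1, 0, 1, 1, 1, 0],
     [0, 1, 1, 1, 1, 0], [0, 1, 0, 1, 1, 1], [0, 0, 1, 1, 1, 1],
     [1, 1, 1, 1, 1, 0], [1, 0, 1, 1, 1, 1], [0, 1, 1, 2, 1, 0],
     [0, 1, 1, 1, 1, 1], [1, 1, 1, 2, 1, 0], [1, 1, 1, 1, 1, 1],
     [0, 1, 1, 2, 1, 1], [1, 1, 2, 2, 1, 0], [1, 1, 1, 2, 1, 1],
     [0, 1, 1, 2, 2, 1], [1, 1, 2, 2, 1, 1], [1, 1, 1, 2, 2, 1],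
     [1, 1, 2, 2, 2, 1], [1, 1, 2, 3, 2, 1], [1, 2, 2, 3, 2, 1]]"

lemma integral_roots_eq:
  "{std i + std k | i k. 1 \<le> k \<and> k < i \<and> i \<le> 5} \<union> {std i - std k | i k. 1 \<le> k \<and> k < i \<and> i \<le> 5}
   = (\<Union>(i, k) \<in> {(2,1),(3,1),(3,2),(4,1),(4,2),(4,3),(5,1),(5,2),(5,3),(5,4)}.
       {std i + std k, std i - std k})"
  (is "?L = \<Union>(?f ` ?pairs)")
proof -
  have "?L = (\<Union>(i, k) \<in> {(i, k). 1 \<le> k \<and> k < i \<and> i \<le> 5}. {std i + std k, std i - std k})"
    by blast
  also have "{(i, k). 1 \<le> k \<and> k < i \<and> i \<le> 5} = (SIGMA i:set [1..<6]. set [1..<i])"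
    unfolding set_upt by auto
  also have "\<dots> = ?pairs"
    by code_simp
  finally show ?thesis .
qed

text \<open>The sign condition makes the fifth sign the product of the other four, which leaves 16 vectors.\<close>

lemma half_integral_roots_eq:
  "{(1/2) *\<^sub>R ((\<Sum>i=1..5. \<nu> i *\<^sub>R std i) - std 6 - std 7 + std 8) | \<nu> :: nat \<Rightarrow> real.
        (\<forall>i\<in>{1..5}. \<nu> i \<in> {1, -1}) \<and> (\<Prod>i=1..5. \<nu> i) = 1}
   = (\<Union>a\<in>{1, -1}. \<Union>b\<in>{1, -1}. \<Union>c\<in>{1, -1}. \<Union>d\<in>{1, -1}.
        {std_comb (a / 2) (b / 2) (c / 2) (d / 2) (a * b * c * d / 2) (-1/2) (-1/2) (1/2)})"
  (is "?L = ?R")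
proof
  have ivl: "{1..5} = {1, 2, 3, 4, 5 :: nat}" by auto
  have root_coords: "(1/2) *\<^sub>R ((\<Sum>i=1..5. \<nu> i *\<^sub>R std i) - std 6 - std 7 + std 8)
      = std_comb (\<nu> 1 / 2) (\<nu> 2 / 2) (\<nu> 3 / 2) (\<nu> 4 / 2) (\<nu> 5 / 2) (-1/2) (-1/2) (1/2)" for \<nu>
    by (simp add: ivl std_as_std_comb std_comb_arith del: One_nat_def)
  have prod: "(\<Prod>i=1..5. \<nu> i) = \<nu> 1 * \<nu> 2 * \<nu> 3 * \<nu> 4 * \<nu> 5" for \<nu> :: "nat \<Rightarrow> real"
    by (simp add: ivl mult.assoc del: One_nat_def)
  show "?L \<subseteq> ?R"
  proof
    fix x assume "x \<in> ?L"
    then obtain \<nu> :: "nat \<Rightarrow> real" where signs: "\<forall>i\<in>{1..5}. \<nu> i \<in> {1, -1}"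
      and p: "\<nu> 1 * \<nu> 2 * \<nu> 3 * \<nu> 4 * \<nu> 5 = 1"
      and x: "x = std_comb (\<nu> 1 / 2) (\<nu> 2 / 2) (\<nu> 3 / 2) (\<nu> 4 / 2) (\<nu> 5 / 2) (-1/2) (-1/2) (1/2)"
      unfolding root_coords prod by blast
    have m: "\<nu> 1 \<in> {1, -1}" "\<nu> 2 \<in> {1, -1}" "\<nu> 3 \<in> {1, -1}" "\<nu> 4 \<in> {1, -1}" "\<nu> 5 \<in> {1, -1}"
      using signs by (auto simp: ivl simp del: One_nat_def)
    have inverse_self: "q = r" if "q * r = 1" "r * r = 1" for q r :: real
      by (metis that mult.assoc mult_1 mult_1_right)
    have "\<nu> 5 * \<nu> 5 = 1"
      using m(5) by auto
    then have "\<nu> 1 * \<nu> 2 * \<nu> 3 * \<nu> 4 = \<nu> 5"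
      using inverse_self p by blast
    then show "x \<in> ?R"
      unfolding x by (intro UN_I[OF m(1)] UN_I[OF m(2)] UN_I[OF m(3)] UN_I[OF m(4)]) simp
  qed
  show "?R \<subseteq> ?L"
  proof
    fix x assume "x \<in> ?R"
    then obtain a b c d :: real where m: "a \<in> {1, -1}" "b \<in> {1, -1}" "c \<in> {1, -1}" "d \<in> {1, -1}"
      and x: "x = std_comb (a / 2) (b / 2) (c / 2) (d / 2) (a * b * c * d / 2) (-1/2) (-1/2) (1/2)"
      by (elim UN_E singletonE) (rule that)
    let ?\<nu> = "\<lambda>i::nat. if i = 1 then a else if i = 2 then b else if i = 3 then c
      else if i = 4 then d else a * b * c * d"
    have "(\<forall>i\<in>{1..5}. ?\<nu> i \<in> {1, -1}) \<and> (\<Prod>i=1..5. ?\<nu> i) = 1"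
      using m by (auto simp: ivl simp del: One_nat_def)
    moreover have "x = (1/2) *\<^sub>R ((\<Sum>i=1..5. ?\<nu> i *\<^sub>R std i) - std 6 - std 7 + std 8)"
      unfolding root_coords x by simp
    ultimately show "x \<in> ?L"
      by (intro CollectI exI[of _ ?\<nu>] conjI) simp_all
  qed
qed

lemma positive_roots_eq: "positive_roots = comb ` set pos_coeffs"
proof -
  have "positive_roots \<subseteq> comb ` set pos_coeffs"
    unfolding positive_roots_def integral_roots_eq half_integral_roots_eq pos_coeffs_def
    by (simp add: std_as_std_comb std_comb_arith comb_as_std_comb std_comb_eq_iff)
  moreover have "comb ` set pos_coeffs \<subseteq> positive_roots"
    unfolding positive_roots_def integral_roots_eq half_integral_roots_eq pos_coeffs_def
    by (simp add: std_as_std_comb std_comb_arith comb_as_std_comb std_comb_eq_iff)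
  ultimately show ?thesis by blast
qed

section \<open>Simple reflections on coefficients\<close>

declare One_nat_def [simp del]

definition unit_coeffs :: "nat \<Rightarrow> int list" where
  "unit_coeffs i = map (\<lambda>k. if k = i then 1 else 0) [1..<7]"

lemma index_cases: "i \<in> {1..6} \<longleftrightarrow> i = 1 \<or> i = 2 \<or> i = 3 \<or> i = 4 \<or> i = 5 \<or> i = 6" for i :: nat
  by auto

lemma unit_coeffs_simps:
  "unit_coeffs 1 = [1, 0, 0, 0, 0, 0]" "unit_coeffs 2 = [0, 1, 0, 0, 0, 0]"
  "unit_coeffs 3 = [0, 0, 1, 0, 0, 0]" "unit_coeffs 4 = [0, 0, 0, 1, 0, 0]"
  "unit_coeffs 5 = [0, 0, 0, 0, 1, 0]" "unit_coeffs 6 = [0, 0, 0, 0, 0, 1]"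
  by code_simp+

lemma simple_root_eq_comb:
  assumes "i \<in> {1..6}"
  shows "simple_root i = comb (unit_coeffs i)"
  using assms unfolding index_cases
  by (elim disjE) (simp_all only: unit_coeffs_simps comb.simps, simp_all)

text \<open>The coefficient of \<open>\<alpha>\<^sub>i\<close> becomes the sum of the coefficients at the neighbours of \<open>i\<close> in the
  Dynkin diagram minus itself. The diagram is the chain 1-3-4-5-6 with 2 attached to 4.\<close>

fun reflect_coeffs :: "nat \<Rightarrow> int list \<Rightarrow> int list" where
  "reflect_coeffs i [a, b, c, d, e, f] =
     (if i = 1 then [c - a, b, c, d, e, f]
      else if i = 2 then [a, d - b, c, d, e, f]
      else if i = 3 then [a, b, a + d - c, d, e, f]
      else if i = 4 then [a, b, c, b + c + e - d, e, f]
      else if i = 5 then [a, b, c, d, d + f - e, f]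
      else [a, b, c, d, e, e - f])"
| "reflect_coeffs i c = c"

lemma reflection_comb:
  assumes "i \<in> {1..6}" "length c = 6"
  shows "root_reflection (simple_root i) (comb c) = comb (reflect_coeffs i c)"
proof -
  obtain a1 a2 a3 a4 a5 a6 where c: "c = [a1, a2, a3, a4, a5, a6]"
    using assms(2) by (rule length_6E)
  show ?thesis
    using assms(1) unfolding c index_cases
    by (elim disjE) (simp_all add: simple_root_eq_comb unit_coeffs_simps root_reflection_def
        comb_as_std_comb inner_std_comb std_comb_arith std_comb_eq_iff field_simps)
qed

lemma length_reflect_coeffs [simp]: "length c = 6 \<Longrightarrow> length (reflect_coeffs i c) = 6"
  by (erule length_6E) auto

lemma comb_uminus:
  assumes "length c = 6"
  shows "- comb c = comb (map uminus c)"
  using assms by (elim length_6E) (simp add: comb_as_std_comb std_comb_arith std_comb_eq_iff)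

lemma length_pos_coeffs: "c \<in> set pos_coeffs \<Longrightarrow> length c = 6"
proof -
  have "\<forall>c\<in>set pos_coeffs. length c = 6" by code_simp
  then show "c \<in> set pos_coeffs \<Longrightarrow> length c = 6" by blast
qed

lemma reflect_pos_coeffs:
  "\<forall>i\<in>set [1..<7]. \<forall>c\<in>set pos_coeffs. c = unit_coeffs i \<or> reflect_coeffs i c \<in> set pos_coeffs"
  by code_simp

text \<open>Every positive root that is not simple is lowered in height by some simple reflection; this
  drives the induction that writes each root reflection as a word in simple ones.\<close>

lemma reflect_pos_coeffs_descent:
  "\<forall>c\<in>set pos_coeffs. \<exists>i\<in>set [1..<7]. c = unit_coeffs i \<or>
     (reflect_coeffs i c \<in> set pos_coeffs \<and> sum_list (reflect_coeffs i c) < sum_list c)"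
  by code_simp

lemma uminus_pos_coeffs: "\<forall>c\<in>set pos_coeffs. map uminus c \<notin> set pos_coeffs"
  by code_simp


lemma simple_root_positive: "i \<in> {1..6} \<Longrightarrow> simple_root i \<in> positive_roots"
  unfolding index_cases positive_roots_eq pos_coeffs_def
  by (elim disjE) (simp_all add: simple_root_eq_comb unit_coeffs_simps)

lemma reflection_positive:
  assumes "\<beta> \<in> positive_roots" "i \<in> {1..6}" "\<beta> \<noteq> simple_root i"
  shows "root_reflection (simple_root i) \<beta> \<in> positive_roots"
proof -
  obtain c where c: "\<beta> = comb c" "c \<in> set pos_coeffs"
    using assms(1) unfolding positive_roots_eq by blast
  have "i \<in> set [1..<7]"
    using assms(2) by auto
  moreover have "c \<noteq> unit_coeffs i"
    using assms c by (auto simp: simple_root_eq_comb)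
  ultimately have "reflect_coeffs i c \<in> set pos_coeffs"
    using reflect_pos_coeffs c(2) by blast
  then show ?thesis
    unfolding c(1) positive_roots_eq
    using reflection_comb[OF assms(2) length_pos_coeffs[OF c(2)]] by simp
qed

lemma uminus_positive: "\<beta> \<in> positive_roots \<Longrightarrow> - \<beta> \<notin> positive_roots"
proof
  assume "\<beta> \<in> positive_roots" "- \<beta> \<in> positive_roots"
  then obtain c c' where c: "c \<in> set pos_coeffs" "c' \<in> set pos_coeffs"
    and "\<beta> = comb c" "- \<beta> = comb c'"
    unfolding positive_roots_eq by blast
  then have "comb (map uminus c) = comb c'"
    by (simp add: comb_uminus length_pos_coeffs)
  then have "map uminus c = c'"
    using c by (simp add: comb_eq_iff length_pos_coeffs)
  then show False
    using uminus_pos_coeffs c by blast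
qed

lemma finite_positive_roots: "finite positive_roots"
  by (simp add: positive_roots_eq)

section \<open>Words in the simple reflections\<close>

lemma orthogonal_root_reflection: "orthogonal_transformation (root_reflection \<beta>)"
proof (cases "\<beta> = 0")
  case True
  then have "root_reflection \<beta> = id"
    by (auto simp: root_reflection_def)
  then show ?thesis
    by (simp add: id_def)
next
  case False
  have "linear (root_reflection \<beta>)"
    by (intro linearI)
      (simp_all add: root_reflection_def add_divide_distrib algebra_simps)
  moreover have "root_reflection \<beta> x \<bullet> root_reflection \<beta> y = x \<bullet> y" for x y
    using False
    by (simp add: root_reflection_def inner_diff_left inner_diff_right inner_commute field_simps)
  ultimately show ?thesis
    by (simp add: orthogonal_transformation_def)
qed

lemma root_reflection_involution [simp]: "root_reflection \<beta> (root_reflection \<beta> x) = x"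
  by (cases "\<beta> = 0") (simp_all add: root_reflection_def algebra_simps)

lemma root_reflection_self: "root_reflection \<beta> \<beta> = - \<beta>"
  by (cases "\<beta> = 0") (simp_all add: root_reflection_def scaleR_2)

lemma root_reflection_uminus: "root_reflection (- \<beta>) = root_reflection \<beta>"
  by (auto simp: root_reflection_def)

lemma root_reflection_conjugate:
  assumes "orthogonal_transformation g"
  shows "root_reflection (g \<beta>) (g x) = g (root_reflection \<beta> x)"
  using assms
  by (simp add: root_reflection_def orthogonal_transformation_def linear_diff linear_cmul)

definition word_map :: "nat list \<Rightarrow> real^8 \<Rightarrow> real^8" where
  "word_map is = foldr (\<lambda>i f. root_reflection (simple_root i) \<circ> f) is id"

lemma word_map_Nil [simp]: "word_map [] = id"
  by (simp add: word_map_def)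

lemma word_map_Cons [simp]: "word_map (i # is) = root_reflection (simple_root i) \<circ> word_map is"
  by (simp add: word_map_def)

lemma word_map_append: "word_map (is @ ks) = word_map is \<circ> word_map ks"
  by (induction "is") (auto simp: comp_assoc)

lemma word_map_rev [simp]: "word_map (rev is) (word_map is x) = x"
  by (induction "is" arbitrary: x) (auto simp: word_map_append)

lemma word_map_rev' [simp]: "word_map is (word_map (rev is) x) = x"
  using word_map_rev[of "rev is" x] by simp

lemma orthogonal_word_map: "orthogonal_transformation (word_map is)"
proof (induction "is")
  case Nil
  show ?case by (simp add: id_def)
next
  case (Cons i "is")
  then show ?case
    unfolding word_map_Cons
    by (intro orthogonal_transformation_compose orthogonal_root_reflection)
qed

lemma word_map_uminus [simp]: "word_map is (- x) = - word_map is x"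
  using orthogonal_word_map[of "is"]
  by (simp add: orthogonal_transformation_def linear_neg)

lemma bij_word_map: "bij (word_map is)"
  by (rule bij_betw_byWitness[where f' = "word_map (rev is)"]) auto

lemma root_iff: "\<beta> \<in> roots \<longleftrightarrow> \<beta> \<in> positive_roots \<or> - \<beta> \<in> positive_roots"
  unfolding roots_def by force

lemma word_map_root:
  "set is \<subseteq> {1..6} \<Longrightarrow> \<beta> \<in> roots \<Longrightarrow> word_map is \<beta> \<in> roots"
proof (induction "is")
  case (Cons i "is")
  have "root_reflection (simple_root i) \<gamma> \<in> roots" if "\<gamma> \<in> positive_roots" for \<gamma>
    using reflection_positive[OF that, of i] simple_root_positive[of i] Cons.prems(1)
    by (cases "\<gamma> = simple_root i") (auto simp: root_iff root_reflection_self)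
  moreover have "root_reflection (simple_root i) (- \<gamma>) = - root_reflection (simple_root i) \<gamma>" for \<gamma>
    using word_map_uminus[of "[i]"] by simp
  ultimately show ?case
    using Cons by (auto simp: root_iff) (metis minus_minus)+
qed simp

section \<open>Length and inversions\<close>

definition inversions :: "(real^8 \<Rightarrow> real^8) \<Rightarrow> (real^8) set" where
  "inversions w = {\<beta> \<in> positive_roots. w \<beta> \<notin> positive_roots}"

lemma finite_inversions [simp]: "finite (inversions w)"
  by (simp add: inversions_def finite_positive_roots)

lemma word_map_negative:
  assumes "set is \<subseteq> {1..6}" "\<beta> \<in> positive_roots" "word_map is \<beta> \<notin> positive_roots"
  shows "- word_map is \<beta> \<in> positive_roots"
  using word_map_root[OF assms(1), of \<beta>] assms(2,3) by (auto simp: root_iff)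

text \<open>Applying the letters of \<open>is\<close> one by one turns the positive root \<open>\<gamma>\<close> negative at some letter
  \<open>k\<close>. Since \<open>\<alpha>\<^sub>k\<close> is the only positive root that the reflection in \<open>\<alpha>\<^sub>k\<close> makes negative, the image of
  \<open>\<gamma>\<close> just before that letter is \<open>\<alpha>\<^sub>k\<close>.\<close>

lemma exchange_position:
  assumes "set is \<subseteq> {1..6}" "\<gamma> \<in> positive_roots" "word_map (rev is) \<gamma> \<notin> positive_roots"
  shows "\<exists>xs k ys. is = xs @ k # ys \<and> word_map (rev xs) \<gamma> = simple_root k"
  using assms
proof (induction "is" arbitrary: \<gamma>)
  case (Cons k ks)
  let ?\<delta> = "root_reflection (simple_root k) \<gamma>"
  show ?case
  proof (cases "\<gamma> = simple_root k")
    case True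
    then show ?thesis
      by (intro exI[of _ "[]"]) auto
  next
    case False
    then have "?\<delta> \<in> positive_roots"
      using reflection_positive Cons.prems by auto
    moreover have "word_map (rev ks) ?\<delta> \<notin> positive_roots"
      using Cons.prems(3) by (simp add: word_map_append)
    ultimately obtain xs l ys where "ks = xs @ l # ys" "word_map (rev xs) ?\<delta> = simple_root l"
      using Cons.IH[of ?\<delta>] Cons.prems(1) by auto
    then show ?thesis
      by (intro exI[of _ "k # xs"]) (auto simp: word_map_append)
  qed
qed simp

text \<open>By the hypothesis the reflections in \<open>\<alpha>\<^sub>i\<close> and \<open>\<alpha>\<^sub>k\<close> are conjugate under \<open>word_map xs\<close>, so the
  letter \<open>i\<close> can be moved past \<open>xs\<close>, where it turns into \<open>k\<close> and cancels.\<close>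

lemma word_map_exchange:
  assumes "word_map (rev xs) (simple_root i) = simple_root k"
  shows "word_map (i # xs @ k # ys) = word_map (xs @ ys)"
proof -
  have "simple_root i = word_map xs (simple_root k)"
    using word_map_rev'[of xs "simple_root i"] assms by simp
  then have "root_reflection (simple_root i) (word_map xs x)
      = word_map xs (root_reflection (simple_root k) x)" for x
    by (simp add: root_reflection_conjugate orthogonal_word_map)
  then show ?thesis
    by (auto simp: word_map_append)
qed

text \<open>Among the roots, the reflection in \<open>\<alpha>\<^sub>i\<close> moves only \<open>\<plusminus> \<alpha>\<^sub>i\<close> between positive and
  negative, so composing with it on the left affects
  one inversion, namely the preimage of \<open>\<plusminus> \<alpha>\<^sub>i\<close>. Here this preimage is positive, so an inversion is
  gained.\<close>

lemma inversions_Cons: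
  assumes "set is \<subseteq> {1..6}" "i \<in> {1..6}"
    and "word_map (rev is) (simple_root i) \<in> positive_roots"
  shows "inversions (word_map (i # is))
    = insert (word_map (rev is) (simple_root i)) (inversions (word_map is))"
proof (rule Set.set_eqI)
  fix \<beta>
  let ?w = "word_map is" and ?s = "root_reflection (simple_root i)"
  show "\<beta> \<in> inversions (word_map (i # is))
      \<longleftrightarrow> \<beta> \<in> insert (word_map (rev is) (simple_root i)) (inversions ?w)"
  proof (cases "?w \<beta> = simple_root i")
    case True
    then have "\<beta> = word_map (rev is) (simple_root i)"
      by (metis word_map_rev)
    then show ?thesis
      using assms True simple_root_positive[of i] uminus_positive[of "simple_root i"]
      by (simp add: inversions_def root_reflection_self)
  next
    case False
    then have ne: "\<beta> \<noteq> word_map (rev is) (simple_root i)"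
      by auto
    have "?s (?w \<beta>) \<in> positive_roots \<longleftrightarrow> ?w \<beta> \<in> positive_roots" if "\<beta> \<in> positive_roots"
    proof
      assume "?w \<beta> \<in> positive_roots"
      then show "?s (?w \<beta>) \<in> positive_roots"
        using reflection_positive assms(2) False by blast
    next
      assume pos: "?s (?w \<beta>) \<in> positive_roots"
      have "?s (?w \<beta>) \<noteq> simple_root i"
      proof
        assume "?s (?w \<beta>) = simple_root i"
        then have "?w \<beta> = - simple_root i"
          by (metis root_reflection_involution root_reflection_self)
        then have "\<beta> = - word_map (rev is) (simple_root i)"
          by (metis word_map_rev word_map_uminus)
        then show False
          using assms(3) uminus_positive that by auto
      qed
      then show "?w \<beta> \<in> positive_roots"
        using reflection_positive[OF pos assms(2)] by simp
    qed
    then show ?thesis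
      using ne by (auto simp: inversions_def)
  qed
qed

text \<open>Reading the word from the right, each letter either adds an inversion or, by the exchange
  lemmas, cancels against an earlier one. Hence a word with fewer inversions than letters can be
  shortened.\<close>

lemma deletion:
  assumes "set is \<subseteq> {1..6}"
  shows "card (inversions (word_map is)) = length is
    \<or> (\<exists>ks. set ks \<subseteq> set is \<and> length ks < length is \<and> word_map ks = word_map is)"
  using assms
proof (induction "is")
  case Nil
  show ?case by (simp add: inversions_def)
next
  case (Cons i "is")
  have i: "i \<in> {1..6}" and "is": "set is \<subseteq> {1..6}"
    using Cons.prems by auto
  let ?\<gamma> = "word_map (rev is) (simple_root i)"
  consider (shorter) ks where "set ks \<subseteq> set is" "length ks < length is" "word_map ks = word_map is"
    | (up) "card (inversions (word_map is)) = length is" "?\<gamma> \<in> positive_roots"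
    | (down) "?\<gamma> \<notin> positive_roots"
    using Cons.IH[OF "is"] by blast
  then show ?case
  proof cases
    case shorter
    then show ?thesis
      by (intro disjI2 exI[of _ "i # ks"]) auto
  next
    case up
    have "?\<gamma> \<notin> inversions (word_map is)"
      using simple_root_positive[OF i] by (simp add: inversions_def)
    then show ?thesis
      using up inversions_Cons[OF "is" i up(2)] by (simp del: word_map_Cons)
  next
    case down
    then obtain xs k ys where "is = xs @ k # ys" "word_map (rev xs) (simple_root i) = simple_root k"
      using exchange_position[OF "is" simple_root_positive[OF i]] by blast
    then show ?thesis
      using word_map_exchange[of xs i k ys] by (intro disjI2 exI[of _ "xs @ ys"]) auto
  qed
qed

lemma shortest_word:
  assumes "set is \<subseteq> {1..6}"
  obtains ks where "set ks \<subseteq> {1..6}" "word_map ks = word_map is"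
    "length ks = weyl_length (word_map is)" "card (inversions (word_map is)) = length ks"
proof -
  let ?P = "\<lambda>n. \<exists>ks. length ks = n \<and> set ks \<subseteq> {1..6} \<and> word_map is = word_map ks"
  have len: "weyl_length (word_map is) = (LEAST n. ?P n)"
    by (simp add: weyl_length_def word_map_def)
  have "?P (length is)"
    using assms by blast
  then have "?P (weyl_length (word_map is))"
    unfolding len by (rule LeastI)
  then obtain ks where ks: "length ks = weyl_length (word_map is)" "set ks \<subseteq> {1..6}"
    "word_map is = word_map ks" by blast
  have "\<not> (\<exists>ls. set ls \<subseteq> set ks \<and> length ls < length ks \<and> word_map ls = word_map ks)"
  proof
    assume "\<exists>ls. set ls \<subseteq> set ks \<and> length ls < length ks \<and> word_map ls = word_map ks"
    then obtain ls where "set ls \<subseteq> set ks" "length ls < length ks" "word_map ls = word_map ks"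
      by blast
    then have "?P (length ls)" and "length ls < (LEAST n. ?P n)"
      using ks len by (auto intro!: exI[of _ ls])
    then show False
      using not_less_Least by blast
  qed
  then have "card (inversions (word_map ks)) = length ks"
    using deletion[OF ks(2)] by blast
  then show thesis
    using that[of ks] ks by simp
qed

lemma weyl_length_eq_card_inversions:
  "set is \<subseteq> {1..6} \<Longrightarrow> weyl_length (word_map is) = card (inversions (word_map is))"
  by (metis shortest_word)

text \<open>A shortest word for an element has as many letters as the element has inversions; without
  inversions it is empty.\<close>

lemma word_map_eq_id:
  assumes "set is \<subseteq> {1..6}" "\<And>\<beta>. \<beta> \<in> positive_roots \<Longrightarrow> word_map is \<beta> \<in> positive_roots"
  shows "word_map is = id"
proof -
  have "inversions (word_map is) = {}"
    using assms(2) by (auto simp: inversions_def)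
  moreover obtain ks where "word_map ks = word_map is" "card (inversions (word_map is)) = length ks"
    using shortest_word[OF assms(1)] .
  ultimately show ?thesis
    by simp
qed

section \<open>Longest elements\<close>

text \<open>The next lemmas translate between the group \<open>BijGroup UNIV\<close> and plain functions, in order to
  describe the generated subgroups by words.\<close>

lemma carrier_BijGroup_UNIV: "f \<in> carrier (BijGroup UNIV) \<longleftrightarrow> bij f"
  by (simp add: BijGroup_def Bij_def)

lemma mult_BijGroup_UNIV: "bij f \<Longrightarrow> bij g \<Longrightarrow> f \<otimes>\<^bsub>BijGroup UNIV\<^esub> g = f \<circ> g"
  by (auto simp: BijGroup_def Bij_def compose_def)

lemma one_BijGroup_UNIV: "\<one>\<^bsub>BijGroup UNIV\<^esub> = id"
  by (auto simp: BijGroup_def)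

lemma inv_root_reflection: "inv\<^bsub>BijGroup UNIV\<^esub> (root_reflection \<beta>) = root_reflection \<beta>"
proof -
  have "bij (root_reflection \<beta>)"
    by (rule bij_betw_byWitness[where f' = "root_reflection \<beta>"]) auto
  moreover from this have "root_reflection \<beta> \<otimes>\<^bsub>BijGroup UNIV\<^esub> root_reflection \<beta> = \<one>\<^bsub>BijGroup UNIV\<^esub>"
    by (auto simp: mult_BijGroup_UNIV one_BijGroup_UNIV)
  ultimately show ?thesis
    by (intro monoid.inv_char group.is_monoid group_BijGroup) (auto simp: carrier_BijGroup_UNIV)
qed

lemma generate_words:
  assumes words: "\<And>r. r \<in> R \<Longrightarrow> \<exists>is. set is \<subseteq> I \<and> root_reflection r = word_map is"
    and simple: "simple_root ` I \<subseteq> R"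
  shows "generate (BijGroup UNIV) (root_reflection ` R) = {word_map is | is. set is \<subseteq> I}"
proof
  show "generate (BijGroup UNIV) (root_reflection ` R) \<subseteq> {word_map is | is. set is \<subseteq> I}"
  proof
    fix w assume "w \<in> generate (BijGroup UNIV) (root_reflection ` R)"
    then show "w \<in> {word_map is | is. set is \<subseteq> I}"
    proof induction
      case one
      show ?case
        by (auto simp: one_BijGroup_UNIV intro!: exI[of _ "[]"])
    next
      case (incl h)
      then show ?case using words by blast
    next
      case (inv h)
      then obtain r where "r \<in> R" "h = root_reflection r"
        by blast
      then show ?case using words by (simp add: inv_root_reflection) blast
    next
      case (eng h1 h2)
      then obtain ks ls where "set ks \<subseteq> I" "h1 = word_map ks" "set ls \<subseteq> I" "h2 = word_map ls"
        by blast
      then show ?case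
        by (auto simp: mult_BijGroup_UNIV bij_word_map word_map_append intro!: exI[of _ "ks @ ls"])
    qed
  qed
  have "word_map is \<in> generate (BijGroup UNIV) (root_reflection ` R)" if "set is \<subseteq> I" for "is"
    using that
  proof (induction "is")
    case Nil
    show ?case
      by (metis generate.one one_BijGroup_UNIV word_map_Nil)
  next
    case (Cons i "is")
    have "root_reflection (simple_root i) \<otimes>\<^bsub>BijGroup UNIV\<^esub> word_map is
        \<in> generate (BijGroup UNIV) (root_reflection ` R)"
      using Cons simple by (intro generate.eng) (auto intro: generate.incl)
    moreover have "bij (root_reflection (simple_root i))"
      using bij_word_map[of "[i]"] by simp
    ultimately show ?case
      by (metis mult_BijGroup_UNIV bij_word_map word_map_Cons)
  qed
  then show "{word_map is | is. set is \<subseteq> I} \<subseteq> generate (BijGroup UNIV) (root_reflection ` R)"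
    by blast
qed

lemma parabolic_eq_words: "parabolic I = {word_map is | is. set is \<subseteq> I}"
proof -
  have "\<exists>is. set is \<subseteq> I \<and> root_reflection r = word_map is" if "r \<in> simple_root ` I" for r
  proof -
    obtain i where "i \<in> I" "r = simple_root i"
      using \<open>r \<in> simple_root ` I\<close> by blast
    then show ?thesis
      by (intro exI[of _ "[i]"]) simp
  qed
  then show ?thesis
    unfolding parabolic_def by (intro generate_words) auto
qed

lemma reflection_is_word:
  "c \<in> set pos_coeffs \<Longrightarrow> \<exists>is. set is \<subseteq> {1..6} \<and> root_reflection (comb c) = word_map is"
proof (induction "nat (sum_list c)" arbitrary: c rule: less_induct)
  case less
  note c = less.prems
  obtain i where i: "i \<in> {1..6}" and "c = unit_coeffs i \<or> (reflect_coeffs i c \<in> set pos_coeffs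
      \<and> sum_list (reflect_coeffs i c) < sum_list c)"
    using reflect_pos_coeffs_descent c by fastforce
  then consider "c = unit_coeffs i"
    | "reflect_coeffs i c \<in> set pos_coeffs" "sum_list (reflect_coeffs i c) < sum_list c"
    by blast
  then show ?case
  proof cases
    case 1
    then show ?thesis
      using i by (intro exI[of _ "[i]"]) (auto simp: simple_root_eq_comb)
  next
    case 2
    \<comment> \<open>Heights are integers; positivity makes \<open>nat\<close> preserve their strict order.\<close>
    have "\<forall>c\<in>set pos_coeffs. sum_list c > 0"
      by code_simp
    then have "nat (sum_list (reflect_coeffs i c)) < nat (sum_list c)"
      using 2 c by simp
    then obtain ks where ks: "set ks \<subseteq> {1..6}"
      "root_reflection (comb (reflect_coeffs i c)) = word_map ks"
      using less.hyps 2(1) by blast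
    let ?s = "root_reflection (simple_root i)"
    have "comb c = ?s (comb (reflect_coeffs i c))"
      using reflection_comb[OF i length_pos_coeffs[OF c]] by (metis root_reflection_involution)
    then have "root_reflection (comb c) x = ?s (word_map ks (?s x))" for x
      using root_reflection_conjugate[OF orthogonal_root_reflection, of "simple_root i"
          "comb (reflect_coeffs i c)" "?s x"] ks(2)
      by simp
    then have "root_reflection (comb c) = word_map (i # ks @ [i])"
      by (auto simp: word_map_append)
    then show ?thesis
      using ks(1) i by (intro exI[of _ "i # ks @ [i]"]) auto
  qed
qed

lemma weyl_group_eq_parabolic: "weyl_group = parabolic {1..6}"
proof -
  have "\<exists>is. set is \<subseteq> {1..6} \<and> root_reflection \<beta> = word_map is" if "\<beta> \<in> roots" for \<beta>
  proof -
    have "\<exists>c\<in>set pos_coeffs. \<beta> = comb c \<or> \<beta> = - comb c"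
      using that unfolding roots_def positive_roots_eq by blast
    then show ?thesis
      using reflection_is_word root_reflection_uminus by auto
  qed
  moreover have "simple_root ` {1..6} \<subseteq> roots"
    using simple_root_positive by (auto simp: roots_def)
  ultimately show ?thesis
    unfolding weyl_group_def parabolic_eq_words by (intro generate_words) auto
qed

text \<open>The set \<open>A\<close> stands for the positive roots of the subgroup generated by the reflections with
  index in \<open>I\<close>: the remaining positive roots stay positive under it. Thus \<open>A\<close> contains all inversions
  of every element, and an element of maximal length has exactly the inversions \<open>A\<close>. If \<open>w\<close> is
  another one, \<open>w\<close> followed by the inverse of \<open>word_map ls\<close> has no inversions, so it is the identity.\<close>

lemma longest_eqI:
  assumes I: "I \<subseteq> {1..6}" and A: "A \<subseteq> positive_roots"
    and stable: "\<And>i \<beta>. i \<in> I \<Longrightarrow> \<beta> \<in> positive_roots - A \<Longrightarrow>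
      root_reflection (simple_root i) \<beta> \<in> positive_roots - A"
    and ls: "set ls \<subseteq> I"
    and neg: "\<And>\<beta>. \<beta> \<in> A \<Longrightarrow> word_map ls \<beta> \<notin> positive_roots"
  shows "longest (parabolic I) = word_map ls"
proof -
  have stable_word: "word_map ks \<beta> \<in> positive_roots - A"
    if "set ks \<subseteq> I" "\<beta> \<in> positive_roots - A" for ks \<beta>
    using that by (induction ks) (auto intro: stable[THEN DiffD1] dest: stable)
  have inv_sub: "inversions (word_map ks) \<subseteq> A" if "set ks \<subseteq> I" for ks
    using stable_word[OF that] by (auto simp: inversions_def)
  have inv_ls: "inversions (word_map ls) = A"
    using inv_sub[OF ls] neg A by (auto simp: inversions_def)
  have length: "weyl_length (word_map ks) = card (inversions (word_map ks))" if "set ks \<subseteq> I" for ks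
    using weyl_length_eq_card_inversions that I by blast
  have finA: "finite A"
    using A finite_positive_roots finite_subset by blast
  show ?thesis
    unfolding longest_def parabolic_eq_words
  proof (rule the_equality)
    show "word_map ls \<in> {word_map is |is. set is \<subseteq> I} \<and>
        (\<forall>v\<in>{word_map is |is. set is \<subseteq> I}. weyl_length v \<le> weyl_length (word_map ls))"
      using ls by (auto simp: length inv_ls intro!: card_mono[OF finA] inv_sub)
  next
    fix w assume w: "w \<in> {word_map is |is. set is \<subseteq> I} \<and>
        (\<forall>v\<in>{word_map is |is. set is \<subseteq> I}. weyl_length v \<le> weyl_length w)"
    then obtain ks where ks: "set ks \<subseteq> I" "w = word_map ks"
      by blast
    have "weyl_length (word_map ls) \<le> weyl_length w"
      using w ls by blast
    then have "card A \<le> card (inversions w)"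
      using ks ls by (simp add: length inv_ls)
    then have inv_w: "inversions w = A"
      using card_seteq[OF finA inv_sub[OF ks(1)]] ks(2) by simp
    have "word_map (rev ls) (w \<beta>) \<in> positive_roots" if \<beta>: "\<beta> \<in> positive_roots" for \<beta>
    proof (cases "\<beta> \<in> A")
      case False
      then show ?thesis
        using stable_word[of "rev ls"] stable_word[of ks \<beta>] \<beta> ks ls by simp
    next
      case True
      define \<delta> where "\<delta> = - w \<beta>"
      have \<delta>: "\<delta> \<in> positive_roots"
        using True inv_w word_map_negative[of ks \<beta>] ks I unfolding \<delta>_def inversions_def by auto
      have "\<delta> \<in> A"
      proof (rule ccontr)
        assume "\<delta> \<notin> A"
        then have "word_map (rev ks) \<delta> \<in> positive_roots"
          using stable_word[of "rev ks" \<delta>] \<delta> ks by simp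
        then show False
          using uminus_positive[OF \<beta>] by (simp add: \<delta>_def ks(2))
      qed
      have "word_map (rev ls) \<delta> \<notin> positive_roots"
      proof
        assume pos: "word_map (rev ls) \<delta> \<in> positive_roots"
        then have "word_map (rev ls) \<delta> \<notin> A"
          using neg \<delta> by (metis word_map_rev')
        then show False
          using stable_word[OF ls, of "word_map (rev ls) \<delta>"] pos \<open>\<delta> \<in> A\<close> by simp
      qed
      then have "- word_map (rev ls) \<delta> \<in> positive_roots"
        using word_map_negative[of "rev ls" \<delta>] \<delta> ls I by auto
      then show ?thesis
        by (simp add: \<delta>_def)
    qed
    then have "word_map (rev ls @ ks) = id"
      using ks ls I by (intro word_map_eq_id) (auto simp: word_map_append)
    then have "word_map (rev ls) (w x) = x" for x
      by (simp add: word_map_append ks(2) fun_eq_iff)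
    then show "w = word_map ls"
      by (metis ext word_map_rev')
  qed
qed

section \<open>The longest elements explicitly\<close>

lemma word_map_comb:
  assumes "set is \<subseteq> {1..6}" "length c = 6"
  shows "word_map is (comb c) = comb (foldr reflect_coeffs is c)"
    "length (foldr reflect_coeffs is c) = 6"
  using assms by (induction "is") (simp_all add: reflection_comb)

text \<open>A reduced word, of length 36, obtained by appending a letter \<open>i\<close> for which the word so far maps
  \<open>\<alpha>\<^sub>i\<close> to a positive root, as long as there is one. The words for the two subgroups of type \<open>D\<^sub>5\<close> below arise in the same way
  and have length 20.\<close>

definition w0_word :: "nat list" where
  "w0_word = [1, 2, 3, 1, 4, 2, 3, 1, 4, 3, 5, 4, 2, 3, 1, 4, 3, 5,
    4, 2, 6, 5, 4, 2, 3, 1, 4, 3, 5, 4, 2, 6, 5, 4, 3, 1]"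

definition wj_word :: "nat \<Rightarrow> nat list" where
  "wj_word j = (if j = 1 then [2, 3, 4, 2, 3, 4, 5, 4, 2, 3, 4, 5, 6, 5, 4, 2, 3, 4, 5, 6]
    else [1, 2, 3, 1, 4, 2, 3, 1, 4, 3, 5, 4, 2, 3, 1, 4, 3, 5, 4, 2])"

lemma set_w0_word: "set w0_word \<subseteq> {1..6}"
  by (simp add: w0_word_def)

lemma set_wj_word: "j \<in> {1, 6} \<Longrightarrow> set (wj_word j) \<subseteq> {1..6} - {j}"
  by (auto simp: wj_word_def)

lemma w0_word_negative: "\<forall>c\<in>set pos_coeffs. foldr reflect_coeffs w0_word c \<notin> set pos_coeffs"
  by code_simp

lemma wj_word_negative:
  "\<forall>j\<in>set [1, 6]. \<forall>c\<in>set pos_coeffs. c ! (j - 1) = 0 \<longrightarrow>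
     foldr reflect_coeffs (wj_word j) c \<notin> set pos_coeffs"
  by code_simp

lemma word_map_comb_negative:
  assumes "set is \<subseteq> {1..6}" "c \<in> set pos_coeffs" "foldr reflect_coeffs is c \<notin> set pos_coeffs"
  shows "word_map is (comb c) \<notin> positive_roots"
  using assms word_map_comb[OF assms(1) length_pos_coeffs[OF assms(2)]]
  by (auto simp: positive_roots_eq comb_eq_iff length_pos_coeffs)

lemma longest_weyl_group: "longest weyl_group = word_map w0_word"
  unfolding weyl_group_eq_parabolic
proof (rule longest_eqI[where A = positive_roots])
  fix \<beta> assume "\<beta> \<in> positive_roots"
  then obtain c where "c \<in> set pos_coeffs" "\<beta> = comb c"
    unfolding positive_roots_eq by blast
  then show "word_map w0_word \<beta> \<notin> positive_roots"
    using word_map_comb_negative[OF set_w0_word] w0_word_negative by blast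
qed (use set_w0_word in auto)

lemma reflect_coeffs_other:
  assumes "length c = 6" "i \<in> {1..6}" "j \<in> {1..6}" "i \<noteq> j"
  shows "reflect_coeffs i c ! (j - 1) = c ! (j - 1)"
proof -
  obtain a1 a2 a3 a4 a5 a6 where "c = [a1, a2, a3, a4, a5, a6]"
    using assms(1) by (rule length_6E)
  then show ?thesis
    using assms(2-4) unfolding index_cases by (elim disjE) simp_all
qed

text \<open>A positive root in which \<open>\<alpha>\<^sub>j\<close> occurs keeps its coefficient at \<open>\<alpha>\<^sub>j\<close> under the reflections with
  other indices, so it stays positive.\<close>

lemma longest_maximal_parabolic:
  assumes j: "j \<in> {1, 6}"
  shows "longest (parabolic ({1..6} - {j})) = word_map (wj_word j)"
proof (rule longest_eqI[where A = "comb ` {c \<in> set pos_coeffs. c ! (j - 1) = 0}"])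
  fix i \<beta>
  assume i: "i \<in> {1..6} - {j}"
    and "\<beta> \<in> positive_roots - comb ` {c \<in> set pos_coeffs. c ! (j - 1) = 0}"
  then obtain c where c: "c \<in> set pos_coeffs" "\<beta> = comb c" "c ! (j - 1) \<noteq> 0"
    unfolding positive_roots_eq by blast
  have len: "length c = 6"
    using c(1) by (rule length_pos_coeffs)
  have coeff: "reflect_coeffs i c ! (j - 1) \<noteq> 0"
    using reflect_coeffs_other[OF len, of i j] i j c(3) by auto
  have "unit_coeffs i ! (j - 1) = 0"
    using i j unfolding unit_coeffs_def by auto
  then have "c \<noteq> unit_coeffs i"
    using c(3) by auto
  moreover have "i \<in> set [1..<7]"
    using i by auto
  ultimately have pos: "reflect_coeffs i c \<in> set pos_coeffs"
    using reflect_pos_coeffs c(1) by blast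
  have "comb (reflect_coeffs i c) \<notin> comb ` {c \<in> set pos_coeffs. c ! (j - 1) = 0}"
    using coeff len by (auto simp: comb_eq_iff length_pos_coeffs)
  moreover have "root_reflection (simple_root i) \<beta> = comb (reflect_coeffs i c)"
    using reflection_comb[of i c] i len c(2) by simp
  ultimately show "root_reflection (simple_root i) \<beta>
      \<in> positive_roots - comb ` {c \<in> set pos_coeffs. c ! (j - 1) = 0}"
    using pos by (simp add: positive_roots_eq)
next
  fix \<beta> assume "\<beta> \<in> comb ` {c \<in> set pos_coeffs. c ! (j - 1) = 0}"
  then obtain c where "c \<in> set pos_coeffs" "\<beta> = comb c" "c ! (j - 1) = 0"
    by blast
  moreover from this have "foldr reflect_coeffs (wj_word j) c \<notin> set pos_coeffs"
    using wj_word_negative j by auto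
  ultimately show "word_map (wj_word j) \<beta> \<notin> positive_roots"
    using word_map_comb_negative[of "wj_word j" c] set_wj_word[OF j] by blast
qed (use set_wj_word[OF j] in \<open>auto simp: positive_roots_eq\<close>)

section \<open>The action of omega\<close>

definition omega_word :: "nat \<Rightarrow> nat list" where
  "omega_word j = wj_word j @ w0_word"

lemma set_omega_word: "j \<in> {1, 6} \<Longrightarrow> set (omega_word j) \<subseteq> {1..6}"
  using set_wj_word[of j] set_w0_word unfolding omega_word_def by auto

lemma omega_eq_word_map: "j \<in> {1, 6} \<Longrightarrow> omega j = word_map (omega_word j)"
  by (simp add: omega_def omega_word_def longest_weyl_group longest_maximal_parabolic word_map_append)

text \<open>The linear map that sends \<open>\<alpha>\<^sub>i\<close> to \<open>\<alpha>\<^bsub>\<sigma> i\<^esub>\<close> for the permutation \<open>\<sigma> = (0 1 6)(2 3 5)\<close> if \<open>j = 1\<close>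
  and its inverse if \<open>j = 6\<close>. One simple root goes to \<open>\<alpha>\<^sub>0\<close>, the negative of the highest root: for \<open>j = 1\<close>
  it is \<open>\<alpha>\<^sub>6\<close> and for \<open>j = 6\<close> it is \<open>\<alpha>\<^sub>1\<close>. This is where the multiples of \<open>f\<close> and \<open>a\<close> come from.\<close>

fun omega_coeffs :: "nat \<Rightarrow> int list \<Rightarrow> int list" where
  "omega_coeffs j [a, b, c, d, e, f] =
     (if j = 1 then [- f, e - 2 * f, b - 2 * f, d - 3 * f, c - 2 * f, a - f]
      else [f - a, c - 2 * a, e - 2 * a, d - 3 * a, b - 2 * a, - a])"
| "omega_coeffs j c = c"

lemma length_omega_coeffs [simp]: "length c = 6 \<Longrightarrow> length (omega_coeffs j c) = 6"
  by (erule length_6E) auto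

lemma omega_word_on_simple_roots:
  "\<forall>j\<in>set [1, 6]. \<forall>c\<in>set (map unit_coeffs [1..<7]).
     foldr reflect_coeffs (omega_word j) c = omega_coeffs j c"
  by code_simp

lemma omega_comb:
  assumes j: "j \<in> {1, 6}" and "length c = 6"
  shows "omega j (comb c) = comb (omega_coeffs j c)"
proof -
  obtain a1 a2 a3 a4 a5 a6 where c: "c = [a1, a2, a3, a4, a5, a6]"
    using assms(2) by (rule length_6E)
  have lin: "linear (omega j)"
    using orthogonal_word_map[of "omega_word j"]
    by (simp add: omega_eq_word_map[OF j] orthogonal_transformation_def)
  have simple: "omega j (simple_root i) = comb (omega_coeffs j (unit_coeffs i))" if "i \<in> {1..6}" for i
  proof -
    have "foldr reflect_coeffs (omega_word j) (unit_coeffs i) = omega_coeffs j (unit_coeffs i)"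
      using omega_word_on_simple_roots j that unfolding set_map set_upt by auto
    then show ?thesis
      using word_map_comb(1)[OF set_omega_word[OF j], of "unit_coeffs i"] that
      by (simp add: omega_eq_word_map[OF j] simple_root_eq_comb unit_coeffs_def)
  qed
  show ?thesis
    using j unfolding c comb.simps
    by (auto simp: linear_add[OF lin] linear_cmul[OF lin] simple unit_coeffs_simps
        comb_as_std_comb std_comb_arith std_comb_eq_iff field_simps)
qed

text \<open>On the roots this is a computation with coefficients. It extends to all vectors because the cube
  is a word in simple reflections without inversions.\<close>

lemma omega_cubed:
  assumes j: "j \<in> {1, 6}"
  shows "omega j (omega j (omega j x)) = x"
proof -
  have "word_map (omega_word j @ omega_word j @ omega_word j) = id"
  proof (rule word_map_eq_id)
    fix \<beta> assume "\<beta> \<in> positive_roots"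
    then obtain c where "\<beta> = comb c" "length c = 6"
      using length_pos_coeffs unfolding positive_roots_eq by blast
    moreover have "omega_coeffs j (omega_coeffs j (omega_coeffs j c)) = c" if "length c = 6"
      using that j by (elim length_6E) auto
    ultimately have "omega j (omega j (omega j \<beta>)) = \<beta>"
      by (simp add: omega_comb[OF j])
    then show "word_map (omega_word j @ omega_word j @ omega_word j) \<beta> \<in> positive_roots"
      using \<open>\<beta> \<in> positive_roots\<close> by (simp add: word_map_append omega_eq_word_map[OF j])
  qed (use set_omega_word[OF j] in auto)
  then show ?thesis
    by (simp add: word_map_append omega_eq_word_map[OF j] fun_eq_iff)
qed

lemma pow_BijGroup_UNIV:
  assumes "bij w"
  shows "w [^]\<^bsub>BijGroup UNIV\<^esub> (n :: nat) = w ^^ n"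
proof (induction n)
  case 0
  show ?case
    by (simp add: one_BijGroup_UNIV)
next
  case (Suc n)
  then show ?case
    using assms by (simp add: mult_BijGroup_UNIV funpow_Suc_right del: funpow.simps)
qed

lemma ord_omega:
  assumes j: "j \<in> {1, 6}"
  shows "group.ord (BijGroup UNIV) (omega j) = 3"
proof -
  interpret group "BijGroup (UNIV :: (real^8) set)"
    by (rule group_BijGroup)
  have bij: "bij (omega j)"
    by (simp add: omega_eq_word_map[OF j] bij_word_map)
  then have carrier: "omega j \<in> carrier (BijGroup UNIV)"
    by (simp add: carrier_BijGroup_UNIV)
  have "omega j ^^ 3 = id"
    using omega_cubed[OF j] by (simp add: fun_eq_iff numeral_3_eq_3)
  then have "ord (omega j) dvd 3"
    using pow_eq_id[OF carrier, of 3] by (simp add: pow_BijGroup_UNIV[OF bij] one_BijGroup_UNIV)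
  moreover have "ord (omega j) \<noteq> 1"
  proof
    assume "ord (omega j) = 1"
    then have "omega j = id"
      using ord_eq_1[OF carrier] by (simp add: one_BijGroup_UNIV)
    then have "comb (omega_coeffs j (unit_coeffs 2)) = comb (unit_coeffs 2)"
      using omega_comb[OF j, of "unit_coeffs 2"] by (simp add: unit_coeffs_simps)
    then show False
      using j by (auto simp: unit_coeffs_simps comb_eq_iff)
  qed
  moreover have "prime (3 :: nat)"
    by simp
  ultimately show ?thesis
    using prime_nat_iff by blast
qed

lemma comb_add:
  "comb [a, b, c, d, e, f] + comb [a', b', c', d', e', f']
    = comb [a + a', b + b', c + c', d + d', e + e', f + f']"
  by (simp add: comb.simps(1) scaleR_add_left)

lemma average_omega:
  assumes j: "j \<in> {1, 6}"
  shows "average (omega j) x = (1/3) *\<^sub>R (omega j x + omega j (omega j x) + x)"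
proof -
  have "{1..3} = {1, 2, 3 :: nat}" by auto
  then show ?thesis
    by (simp add: average_def ord_omega[OF j] omega_cubed[OF j] numeral_2_eq_2 numeral_3_eq_3 One_nat_def
        add.assoc)
qed

text \<open>The two conditions say that three times the average of \<open>comb c\<close> has coefficient 0 at \<open>\<alpha>\<^sub>4\<close> and at \<open>\<alpha>\<^sub>2\<close>, \<open>\<alpha>\<^sub>3\<close>, \<open>\<alpha>\<^sub>5\<close>.\<close>

lemma average_omega_comb_eq_0_iff:
  assumes j: "j \<in> {1, 6}" and "length c = 6"
  shows "average (omega j) (comb c) = 0
    \<longleftrightarrow> c ! 3 = c ! 0 + c ! 5 \<and> c ! 1 + c ! 2 + c ! 4 = 2 * (c ! 0 + c ! 5)"
proof -
  obtain a b c' d e f where c: "c = [a, b, c', d, e, f]"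
    using assms(2) by (rule length_6E)
  let ?x = "comb [a, b, c', d, e, f]"
  have "average (omega j) ?x = 0 \<longleftrightarrow> omega j ?x + omega j (omega j ?x) + ?x = 0"
    by (simp add: average_omega[OF j])
  also have "omega j ?x + omega j (omega j ?x) + ?x
    = comb [0, b + c' + e - 2 * (a + f), b + c' + e - 2 * (a + f),
      3 * (d - (a + f)), b + c' + e - 2 * (a + f), 0]"
    using j by (elim insertE emptyE) (simp_all add: omega_comb comb_add algebra_simps)
  also have "\<dots> = 0 \<longleftrightarrow> \<dots> = comb [0, 0, 0, 0, 0, 0]"
    by (simp add: comb.simps(1))
  also have "\<dots> \<longleftrightarrow> d = a + f \<and> b + c' + e = 2 * (a + f)"
    by (auto simp: comb_eq_iff)
  finally show ?thesis
    by (simp add: c)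
qed

lemma positive_roots_avg0_eq:
  assumes j: "j \<in> {1, 6}"
  shows "positive_roots_avg0 j = comb `
    {[1, 1, 1, 1, 0, 0], [1, 0, 1, 1, 1, 0], [0, 1, 0, 1, 1, 1],
     [0, 0, 1, 1, 1, 1], [1, 1, 2, 2, 1, 1], [1, 1, 1, 2, 2, 1]}"
proof -
  have "positive_roots_avg0 j = comb ` {c \<in> set pos_coeffs. average (omega j) (comb c) = 0}"
    unfolding positive_roots_avg0_def positive_roots_eq by blast
  also have "{c \<in> set pos_coeffs. average (omega j) (comb c) = 0}
    = set (filter (\<lambda>c. c ! 3 = c ! 0 + c ! 5 \<and> c ! 1 + c ! 2 + c ! 4 = 2 * (c ! 0 + c ! 5)) pos_coeffs)"
    using average_omega_comb_eq_0_iff[OF j] length_pos_coeffs by auto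
  also have "filter (\<lambda>c. c ! 3 = c ! 0 + c ! 5 \<and> c ! 1 + c ! 2 + c ! 4 = 2 * (c ! 0 + c ! 5)) pos_coeffs
    = [[1, 1, 1, 1, 0, 0], [1, 0, 1, 1, 1, 0], [0, 1, 0, 1, 1, 1],
       [0, 0, 1, 1, 1, 1], [1, 1, 2, 2, 1, 1], [1, 1, 1, 2, 2, 1]]"
    by code_simp
  finally show ?thesis by simp
qed

section \<open>The highest root and the coweights\<close>

definition affine_coeffs :: "nat \<Rightarrow> int list" where
  "affine_coeffs k = (if k = 0 then [- 1, - 2, - 2, - 3, - 2, - 1] else unit_coeffs k)"

lemma length_affine_coeffs [simp]: "length (affine_coeffs k) = 6"
  by (simp add: affine_coeffs_def unit_coeffs_def)

text \<open>By linear independence of the simple roots, the order that defines the highest root implies the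
  coefficientwise order.\<close>

lemma comb_diff_nonneg:
  assumes "length c = 6" "length c' = 6"
    and "comb c - comb c' = (\<Sum>i=1..6. of_nat (n i) *\<^sub>R simple_root i)" "k < 6"
  shows "c' ! k \<le> c ! k"
proof -
  obtain a1 a2 a3 a4 a5 a6 where c: "c = [a1, a2, a3, a4, a5, a6]"
    using assms(1) by (rule length_6E)
  obtain b1 b2 b3 b4 b5 b6 where c': "c' = [b1, b2, b3, b4, b5, b6]"
    using assms(2) by (rule length_6E)
  have ivl: "{1..6} = {1, 2, 3, 4, 5, 6 :: nat}" by auto
  have "comb c - comb c' = comb [a1 - b1, a2 - b2, a3 - b3, a4 - b4, a5 - b5, a6 - b6]"
    by (simp add: c c' comb.simps(1) algebra_simps)
  moreover have "(\<Sum>i=1..6. of_nat (n i) *\<^sub>R simple_root i)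
      = comb [int (n 1), int (n 2), int (n 3), int (n 4), int (n 5), int (n 6)]"
    by (simp add: ivl comb.simps(1) add.assoc)
  ultimately have "[a1 - b1, a2 - b2, a3 - b3, a4 - b4, a5 - b5, a6 - b6]
      = [int (n 1), int (n 2), int (n 3), int (n 4), int (n 5), int (n 6)]"
    using assms(3) comb_eq_iff by simp
  moreover have "k = 0 \<or> k = 1 \<or> k = 2 \<or> k = 3 \<or> k = 4 \<or> k = 5"
    using \<open>k < 6\<close> by auto
  ultimately show ?thesis
    unfolding c c' by auto
qed

lemma root_coeffs:
  assumes "\<gamma> \<in> roots"
  obtains c where "\<gamma> = comb c" "length c = 6" "c \<in> set pos_coeffs \<or> map uminus c \<in> set pos_coeffs"
proof -
  obtain c where c: "c \<in> set pos_coeffs" "\<gamma> = comb c \<or> \<gamma> = - comb c"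
    using assms unfolding roots_def positive_roots_eq by blast
  show thesis
    using c(2)
  proof
    assume "\<gamma> = comb c"
    then show thesis
      using c(1) length_pos_coeffs by (intro that[of c]) auto
  next
    assume "\<gamma> = - comb c"
    then show thesis
      using c(1) length_pos_coeffs
      by (intro that[of "map uminus c"]) (auto simp: comb_uminus)
  qed
qed

lemma highest_root_eq: "highest_root = comb [1, 2, 2, 3, 2, 1]"
  unfolding highest_root_def
proof (rule the_equality)
  have pos: "comb [1, 2, 2, 3, 2, 1] \<in> roots"
    by (simp add: roots_def positive_roots_eq pos_coeffs_def)
  have ivl: "{1..6} = {1, 2, 3, 4, 5, 6 :: nat}" by auto
  have "\<exists>n. comb [1, 2, 2, 3, 2, 1] - \<gamma> = (\<Sum>i=1..6. of_nat (n i) *\<^sub>R simple_root i)"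
    if "\<gamma> \<in> roots" for \<gamma>
  proof -
    obtain c where c: "\<gamma> = comb c" "length c = 6" "c \<in> set pos_coeffs \<or> map uminus c \<in> set pos_coeffs"
      using root_coeffs[OF \<open>\<gamma> \<in> roots\<close>] .
    obtain a1 a2 a3 a4 a5 a6 where c': "c = [a1, a2, a3, a4, a5, a6]"
      using c(2) by (rule length_6E)
    have bounds: "a1 \<le> 1" "a2 \<le> 2" "a3 \<le> 2" "a4 \<le> 3" "a5 \<le> 2" "a6 \<le> 1"
      using c(3) unfolding c' pos_coeffs_def by auto
    show ?thesis
      by (rule exI[of _ "\<lambda>i. nat ([1, 2, 2, 3, 2, 1] ! (i - 1) - c ! (i - 1))"])
        (use bounds in \<open>simp add: ivl c(1) c' comb.simps(1) algebra_simps\<close>)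
  qed
  then show "comb [1, 2, 2, 3, 2, 1] \<in> roots \<and> (\<forall>\<gamma>\<in>roots.
      \<exists>n. comb [1, 2, 2, 3, 2, 1] - \<gamma> = (\<Sum>i=1..6. of_nat (n i) *\<^sub>R simple_root i))"
    using pos by blast
  fix \<beta>
  assume \<beta>: "\<beta> \<in> roots \<and>
    (\<forall>\<gamma>\<in>roots. \<exists>n. \<beta> - \<gamma> = (\<Sum>i=1..6. of_nat (n i) *\<^sub>R simple_root i))"
  then obtain c where c: "\<beta> = comb c" "length c = 6" "c \<in> set pos_coeffs \<or> map uminus c \<in> set pos_coeffs"
    using root_coeffs by blast
  obtain n where "comb c - comb [1, 2, 2, 3, 2, 1] = (\<Sum>i=1..6. of_nat (n i) *\<^sub>R simple_root i)"
    using \<beta> pos c(1) by blast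
  then have "[1, 2, 2, 3, 2, 1] ! k \<le> c ! k" if "k < 6" for k
    using comb_diff_nonneg[OF c(2)] that by simp
  \<comment> \<open>The highest root is the only one with coefficient at least 2 at \<open>\<alpha>\<^sub>2\<close>.\<close>
  from this[of 0] this[of 1]
  have "c = [1, 2, 2, 3, 2, 1]"
    using c(3) by (auto simp: pos_coeffs_def)
  then show "\<beta> = comb [1, 2, 2, 3, 2, 1]"
    using c(1) by simp
qed

lemma affine_root_eq_comb: "k \<in> {0..6} \<Longrightarrow> affine_root k = comb (affine_coeffs k)"
  by (auto simp: affine_root_def affine_coeffs_def highest_root_eq comb_uminus simple_root_eq_comb)

lemma index_perm_eqI:
  assumes "j \<in> {1, 6}" "i \<in> {0..6}" "k \<in> {0..6}"
    and "omega_coeffs j (affine_coeffs i) = affine_coeffs k"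
  shows "index_perm j i = k"
  unfolding index_perm_def
proof (rule the_equality)
  show "k \<in> {0..6} \<and> omega j (affine_root i) = affine_root k"
    using assms by (simp add: affine_root_eq_comb omega_comb)
  fix l assume "l \<in> {0..6} \<and> omega j (affine_root i) = affine_root l"
  then have l: "l \<in> {0..6}" "affine_coeffs l = affine_coeffs k"
    using assms by (auto simp: affine_root_eq_comb omega_comb comb_eq_iff)
  have "\<forall>k\<in>set [0..<7]. \<forall>l\<in>set [0..<7]. affine_coeffs l = affine_coeffs k \<longrightarrow> l = k"
    by code_simp
  then show "l = k"
    using l assms(3) unfolding set_upt by auto
qed

lemma orbit_index_perm:
  assumes j: "j \<in> {1, 6}"
  shows "orbit (index_perm j) 0 = {0, 1, 6}"
proof -
  have image: "index_perm j i = k"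
    if "(i, k) \<in> (if j = 1 then {(0, 1), (1, 6), (6, 0)} else {(0, 6), (6, 1), (1, 0)})" for i k
    using that j
    by (intro index_perm_eqI[OF j]) (auto simp: affine_coeffs_def unit_coeffs_simps split: if_splits)
  obtain x y where xy: "{x, y} = {1, 6}" "index_perm j 0 = x" "index_perm j x = y" "index_perm j y = 0"
  proof (cases "j = 1")
    case True
    then show thesis
      using image by (intro that[of 1 6]) auto
  next
    case False
    then show thesis
      using image by (intro that[of 6 1]) auto
  qed
  have "z \<in> {0, x, y}" if "z \<in> orbit (index_perm j) 0" for z
    using that by (induction rule: orbit.induct) (use xy(2-4) in auto)
  moreover have x: "x \<in> orbit (index_perm j) 0"
    using orbit.base[of "index_perm j" 0] xy(2) by simp
  moreover have y: "y \<in> orbit (index_perm j) 0"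
    using orbit.step[OF x] xy(3) by simp
  moreover have "0 \<in> orbit (index_perm j) 0"
    using orbit.step[OF y] xy(4) by simp
  ultimately have "orbit (index_perm j) 0 = insert 0 {x, y}"
    by blast
  then show ?thesis
    by (simp only: xy(1))
qed

text \<open>Two candidates differ by a vector in the span of the roots that is orthogonal to all simple
  roots, hence to itself.\<close>

lemma fund_coweight_eqI:
  assumes "i \<noteq> 0" "v \<in> span roots"
    and "\<And>k. k \<in> {1..6} \<Longrightarrow> simple_root k \<bullet> v = (if k = i then 1 else 0)"
  shows "fund_coweight i = v"
proof -
  have unique: "u = v" if u: "u \<in> span roots" "\<forall>k\<in>{1..6}. simple_root k \<bullet> u = (if k = i then 1 else 0)" for u
  proof -
    have simple: "simple_root k \<bullet> (u - v) = 0" if "k \<in> {1..6}" for k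
      using u(2) assms(3) that by (simp add: inner_diff_right)
    have "orthogonal (u - v) \<gamma>" if "\<gamma> \<in> roots" for \<gamma>
    proof -
      obtain c where c: "\<gamma> = comb c" "length c = 6"
        using root_coeffs[OF \<open>\<gamma> \<in> roots\<close>] by blast
      show ?thesis
        using c(2) simple unfolding c(1)
        by (elim length_6E)
          (simp add: orthogonal_def comb.simps(1) inner_add_right inner_commute[of "u - v"])
    qed
    moreover have "u - v \<in> span roots"
      using u(1) assms(2) by (rule span_diff)
    ultimately have "orthogonal (u - v) (u - v)"
      using orthogonal_to_span by blast
    then show "u = v"
      by (simp add: orthogonal_def)
  qed
  have "(THE v. v \<in> span roots \<and> (\<forall>k\<in>{1..6}. simple_root k \<bullet> v = (if k = i then 1 else 0))) = v"
    by (rule the_equality) (use assms(2,3) unique in blast)+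
  then show ?thesis
    using assms(1) by (simp add: fund_coweight_def)
qed

lemma comb_in_span_roots: "length c = 6 \<Longrightarrow> comb c \<in> span roots"
proof (elim length_6E)
  fix a1 a2 a3 a4 a5 a6 assume "c = [a1, a2, a3, a4, a5, a6]"
  moreover have "simple_root i \<in> roots" if "i \<in> {1..6}" for i
    using simple_root_positive[OF that] by (simp add: roots_def)
  ultimately show "comb c \<in> span roots"
    by (simp add: comb.simps(1) span_add span_scale span_base)
qed

text \<open>The coefficients of the two coweights are the rows 1 and 6 of the inverse of the Cartan matrix,
  cleared of the denominator 3.\<close>

lemma fund_coweight_1: "fund_coweight 1 = (1/3) *\<^sub>R comb [4, 3, 5, 6, 4, 2]"
proof (rule fund_coweight_eqI)
  show "simple_root k \<bullet> ((1/3) *\<^sub>R comb [4, 3, 5, 6, 4, 2]) = (if k = 1 then 1 else 0)"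
    if "k \<in> {1..6}" for k
    using that unfolding index_cases
    by (elim disjE)
      (simp_all add: simple_root_eq_comb unit_coeffs_simps comb_as_std_comb inner_std_comb)
qed (simp_all add: span_scale comb_in_span_roots)

lemma fund_coweight_6: "fund_coweight 6 = (1/3) *\<^sub>R comb [2, 3, 4, 6, 5, 4]"
proof (rule fund_coweight_eqI)
  show "simple_root k \<bullet> ((1/3) *\<^sub>R comb [2, 3, 4, 6, 5, 4]) = (if k = 6 then 1 else 0)"
    if "k \<in> {1..6}" for k
    using that unfolding index_cases
    by (elim disjE)
      (simp_all add: simple_root_eq_comb unit_coeffs_simps comb_as_std_comb inner_std_comb)
qed (simp_all add: span_scale comb_in_span_roots)

lemma pi0_eq:
  assumes j: "j \<in> {1, 6}"
  shows "pi0 j = comb [2, 2, 3, 4, 3, 2]"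
proof -
  have "pi0 j = fund_coweight 0 + (fund_coweight 1 + fund_coweight 6)"
    by (simp add: pi0_def orbit_index_perm[OF j])
  also have "\<dots> = comb [2, 2, 3, 4, 3, 2]"
    unfolding fund_coweight_1 fund_coweight_6
    by (simp add: fund_coweight_def comb_as_std_comb std_comb_arith std_comb_eq_iff)
  finally show ?thesis .
qed

lemma comb_inner_pi0:
  "j \<in> {1, 6} \<Longrightarrow> comb [a, b, c, d, e, f] \<bullet> pi0 j = a + f"
  by (simp add: pi0_eq comb_as_std_comb inner_std_comb field_simps)

lemma P0_eq:
  assumes j: "j \<in> {1, 6}"
  shows "P0 j = (\<lambda>\<beta>. \<beta> \<bullet> pi0 j) ` positive_roots_avg0 j \<union> (\<lambda>\<beta>. - (\<beta> \<bullet> pi0 j)) ` positive_roots_avg0 j"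
proof -
  have "omega j (- x) = - omega j x" for x
    by (simp add: omega_eq_word_map[OF j])
  then have neg: "average (omega j) (- x) = - average (omega j) x" for x
    by (simp add: average_omega[OF j] flip: minus_add_distrib scaleR_minus_right)
  have "{\<gamma> \<in> roots. average (omega j) \<gamma> = 0}
      = positive_roots_avg0 j \<union> uminus ` positive_roots_avg0 j"
    by (auto simp: roots_def positive_roots_avg0_def neg)
  moreover have "P0 j = (\<lambda>\<gamma>. \<gamma> \<bullet> pi0 j) ` {\<gamma> \<in> roots. average (omega j) \<gamma> = 0}"
    unfolding P0_def by blast
  ultimately show ?thesis
    by (simp add: image_Un image_image)
qed

theorem proposition5p18:
  fixes j :: nat
  assumes "j \<in> {1, 6}"
  shows "card (positive_roots_avg0 j) = 6 \<and>
    positive_roots_avg0 j =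
      {(1/2) *\<^sub>R (std 1 + std 2 + std 3 - std 4 - std 5 - std 6 - std 7 + std 8),
       (1/2) *\<^sub>R (- std 1 - std 2 - std 3 + std 4 - std 5 - std 6 - std 7 + std 8),
       std 5 + std 1,
       std 5 - std 1,
       (1/2) *\<^sub>R (- std 1 + std 2 + std 3 - std 4 + std 5 - std 6 - std 7 + std 8),
       (1/2) *\<^sub>R (std 1 - std 2 - std 3 + std 4 + std 5 - std 6 - std 7 + std 8)} \<and>
    positive_roots_avg0 j =
      {simple_root 1 + simple_root 2 + simple_root 3 + simple_root 4,
       simple_root 1 + simple_root 3 + simple_root 4 + simple_root 5,
       simple_root 2 + simple_root 4 + simple_root 5 + simple_root 6,
       simple_root 3 + simple_root 4 + simple_root 5 + simple_root 6,
       simple_root 1 + simple_root 2 + 2 *\<^sub>R simple_root 3 + 2 *\<^sub>R simple_root 4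
         + simple_root 5 + simple_root 6,
       simple_root 1 + simple_root 2 + simple_root 3 + 2 *\<^sub>R simple_root 4
         + 2 *\<^sub>R simple_root 5 + simple_root 6} \<and>
    P0 j = {1, -1, 2, -2}"
proof (intro conjI)
  note roots = positive_roots_avg0_eq[OF assms]
  show "card (positive_roots_avg0 j) = 6"
    unfolding roots by (simp add: comb_eq_iff)
  show "P0 j = {1, -1, 2, -2}"
    unfolding P0_eq[OF assms] roots by (auto simp: comb_inner_pi0[OF assms])
qed (unfold positive_roots_avg0_eq[OF assms],
    simp_all add: comb_as_std_comb std_as_std_comb std_comb_arith std_comb_eq_iff
      simple_root_eq_comb unit_coeffs_simps)

end
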